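(* Let $\ell\ge 1$ be an integer, let $F$ be a free group, let $H$ be a normal subgroup of infinite index in $F$, and let $H(\ell)=\langle S\rangle_{\ell}^{H}$ be the $\ell$-subnormal closure in $H$ of a finite subset $S$ of $H$. Then $H(\ell)$ does not contain nontrivial $\ell$-subnormal subgroups of $F$.
   Context: A subgroup $K$ of a group $G$ is called $\ell$-subnormal in $G$ ($\ell=1,2,\dots$) if there is a decreasing sequence $G\triangleright K_1\triangleright\dots\triangleright K_{\ell}=K$ in which each term is a normal subgroup of the preceding one (not necessarily proper). For a subset $S\subset G$, the $\ell$-subnormal closure $\langle S\rangle_{\ell}^{G}$ is defined by induction: $\langle S\rangle_1^{G}=\langle S\rangle^{G}$ is the normal closure of $S$ in $G$ (the smallest normal subgroup of $G$ containing $S$), and for $\ell\ge 2$, $\langle S\rangle_{\ell}^{G}$ is the normal closure of $S$ in the group $\langle S\rangle_{\ell-1}^{G}$. *)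

theory Defs
  imports "HOL-Algebra.Coset"
begin

text \<open>
  A word is a list of letters; the letter \<open>(x, True)\<close> stands for \<open>x\<close> and
  \<open>(x, False)\<close> for the inverse of \<open>x\<close>.
\<close>

definition letter_value :: "('a, 'b) monoid_scheme \<Rightarrow> 'a \<times> bool \<Rightarrow> 'a" where
  "letter_value G a = (if snd a then fst a else inv\<^bsub>G\<^esub> (fst a))"

definition word_value :: "('a, 'b) monoid_scheme \<Rightarrow> ('a \<times> bool) list \<Rightarrow> 'a" where
  "word_value G w = foldr (\<otimes>\<^bsub>G\<^esub>) (map (letter_value G) w) \<one>\<^bsub>G\<^esub>"

definition reduced_word :: "('a \<times> bool) list \<Rightarrow> bool" where
  "reduced_word w \<longleftrightarrow> successively (\<lambda>a b. \<not> (fst a = fst b \<and> snd a \<noteq> snd b)) w"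

text \<open>
  A group is free on a subset \<open>X\<close> if each of its elements is the value of exactly one
  reduced word over \<open>X\<close>. The set \<open>X\<close> may be infinite.
\<close>

definition free_basis :: "('a, 'b) monoid_scheme \<Rightarrow> 'a set \<Rightarrow> bool" where
  "free_basis G X \<longleftrightarrow> X \<subseteq> carrier G \<and>
     bij_betw (word_value G) {w. fst ` set w \<subseteq> X \<and> reduced_word w} (carrier G)"

definition free_group :: "('a, 'b) monoid_scheme \<Rightarrow> bool" where
  "free_group G \<longleftrightarrow> group G \<and> (\<exists>X. free_basis G X)"

definition subnormal :: "nat \<Rightarrow> 'a set \<Rightarrow> ('a, 'b) monoid_scheme \<Rightarrow> bool" where
  "subnormal l K G \<longleftrightarrow>
     (\<exists>C :: nat \<Rightarrow> 'a set. C 0 = carrier G \<and> C l = K \<and>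
        (\<forall>i<l. C (Suc i) \<lhd> G\<lparr>carrier := C i\<rparr>))"

definition normal_closure :: "('a, 'b) monoid_scheme \<Rightarrow> 'a set \<Rightarrow> 'a set" where
  "normal_closure G S = \<Inter>{N. N \<lhd> G \<and> S \<subseteq> N}"

text \<open>
  The recursion starts one step early, at \<open>l = 0\<close> with the whole group, so that \<open>l = 1\<close>
  gives the normal closure in \<open>G\<close> itself.
\<close>

primrec subnormal_closure :: "('a, 'b) monoid_scheme \<Rightarrow> 'a set \<Rightarrow> nat \<Rightarrow> 'a set" where
  "subnormal_closure G S 0 = carrier G"
| "subnormal_closure G S (Suc l) = normal_closure (G\<lparr>carrier := subnormal_closure G S l\<rparr>) S"

end

theory Submission
  imports Defs
begin

text \<open>
  Everything rests on one fact about normal closures: if \<open>H\<close> has infinitely many cosets \<open>H #> n\<close>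
  with \<open>n\<close> in a set \<open>N\<close> normalizing \<open>H\<close>, then every \<open>k \<noteq> \<one>\<close> in \<open>H\<close> has a conjugate by some
  \<open>n \<in> N\<close> outside the normal closure in \<open>H\<close> of a given finite \<open>S \<subseteq> H\<close>
  (\<open>conjugate_not_in_normal_closure\<close>). Think of \<open>H\<close> as the fundamental group of the graph of its
  right cosets, whose edges lead from \<open>H #> g\<close> to \<open>H #> (g \<otimes> x)\<close> for \<open>x\<close> in the basis. The loops
  in \<open>S\<close> visit finitely many vertices. Collapse the edges starting there and label each remaining
  edge by its generator \<open>x\<close>: reading labels along loops is a homomorphism from \<open>H\<close> to the free
  group that kills \<open>S\<close>. Since \<open>N\<close> normalizes \<open>H\<close>, its elements act on the graph
  by \<open>H #> g \<mapsto> H #> (n \<otimes> g)\<close>, and some \<open>n\<close> carries the loop of \<open>k\<close> away from the collapsed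
  edges. The labels along the translated loop then spell \<open>k\<close>, so the conjugate \<open>n \<otimes> k \<otimes> inv n\<close> survives up to conjugation.

  The same fact, applied to \<open>S\<close> enlarged by finitely many coset representatives, shows that a
  nontrivial subgroup of \<open>H\<close> normalized by \<open>N\<close> meets infinitely many cosets of the normal closure
  of \<open>S\<close> (\<open>infinite_cosets_normal_closure\<close>). So the hypothesis of infinite index passes from one
  level of the two subnormal chains, the one ending in \<open>K\<close> and the one ending in the subnormal
  closure of \<open>S\<close>, to the next, and the theorem follows by induction on \<open>l\<close>.
\<close>

section \<open>Words in a free group\<close>

definition inverse_letter :: "'a \<times> bool \<Rightarrow> 'a \<times> bool" where
  "inverse_letter a = (fst a, \<not> snd a)"

lemma not_reduced_wordE:
  assumes "\<not> reduced_word w"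
  obtains u a v where "w = u @ a # inverse_letter a # v"
proof -
  have "\<exists>u a v. w = u @ a # inverse_letter a # v"
    using assms
  proof (induction w)
    case Nil
    then show ?case by (simp add: reduced_word_def)
  next
    case (Cons b w)
    show ?case
    proof (cases "reduced_word w")
      case True
      with Cons.prems obtain a v where w: "w = a # v" and "fst b = fst a" "snd b \<noteq> snd a"
        by (cases w) (auto simp: reduced_word_def)
      then have "a = inverse_letter b"
        by (auto simp: inverse_letter_def prod_eq_iff)
      with w have "b # w = [] @ b # inverse_letter b # v" by simp
      then show ?thesis by blast
    next
      case False
      with Cons.IH obtain u a v where "w = u @ a # inverse_letter a # v" by blast
      then have "b # w = (b # u) @ a # inverse_letter a # v" by simp
      then show ?thesis by blast
    qed
  qed
  with that show thesis by blast
qed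

context group
begin

lemma letter_value_closed: "fst a \<in> carrier G \<Longrightarrow> letter_value G a \<in> carrier G"
  by (simp add: letter_value_def)

lemma letter_value_inverse:
  "fst a \<in> carrier G \<Longrightarrow> letter_value G (inverse_letter a) = inv (letter_value G a)"
  by (simp add: letter_value_def inverse_letter_def)

lemma word_value_Nil [simp]: "word_value G [] = \<one>"
  by (simp add: word_value_def)

lemma word_value_Cons [simp]: "word_value G (a # w) = letter_value G a \<otimes> word_value G w"
  by (simp add: word_value_def)

lemma word_value_closed: "fst ` set w \<subseteq> carrier G \<Longrightarrow> word_value G w \<in> carrier G"
  by (induction w) (auto simp: letter_value_closed)

lemma word_value_append:
  "\<lbrakk>fst ` set u \<subseteq> carrier G; fst ` set v \<subseteq> carrier G\<rbrakk>
    \<Longrightarrow> word_value G (u @ v) = word_value G u \<otimes> word_value G v"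
  by (induction u) (auto simp: letter_value_closed word_value_closed m_assoc)

lemma word_value_cancel:
  assumes "fst ` set (u @ a # v) \<subseteq> carrier G"
  shows "word_value G (u @ a # inverse_letter a # v) = word_value G (u @ v)"
proof -
  have u: "fst ` set u \<subseteq> carrier G" and v: "fst ` set v \<subseteq> carrier G" and a: "fst a \<in> carrier G"
    and a': "fst (inverse_letter a) \<in> carrier G"
    using assms by (auto simp: inverse_letter_def)
  have "word_value G (a # inverse_letter a # v) =
      (letter_value G a \<otimes> letter_value G (inverse_letter a)) \<otimes> word_value G v"
    using a a' v by (simp add: m_assoc letter_value_closed word_value_closed)
  also have "\<dots> = word_value G v"
    using a v by (simp add: letter_value_inverse letter_value_closed word_value_closed)
  finally show ?thesis
    using word_value_append [of u "a # inverse_letter a # v"] word_value_append [of u v] u v a a'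
    by simp
qed

text \<open>
  This is the universal property of a free group in the form in which it is used below: every
  word can be cancelled down to a reduced one, and a reduced word is determined by its value, so
  whatever survives cancellation depends on the value only.
\<close>

lemma free_basis_word_invariant:
  assumes basis: "free_basis G X"
    and cancel: "\<And>u a v. fst ` set (u @ a # v) \<subseteq> X \<Longrightarrow> f (u @ a # inverse_letter a # v) = f (u @ v)"
    and "fst ` set w \<subseteq> X" "fst ` set w' \<subseteq> X"
    and eq: "word_value G w = word_value G w'"
  shows "f w = f w'"
proof -
  have X: "X \<subseteq> carrier G"
    using basis by (simp add: free_basis_def)
  have reduce: "\<exists>r. fst ` set r \<subseteq> X \<and> reduced_word r \<and> word_value G r = word_value G w \<and> f r = f w"
    if "fst ` set w \<subseteq> X" for w
    using that
  proof (induction w rule: length_induct)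
    case (1 w)
    show ?case
    proof (cases "reduced_word w")
      case True
      with 1 show ?thesis by blast
    next
      case False
      then obtain u a v where w: "w = u @ a # inverse_letter a # v"
        by (rule not_reduced_wordE)
      then have uav: "fst ` set (u @ a # v) \<subseteq> X"
        using "1.prems" by auto
      then have "length (u @ v) < length w" "fst ` set (u @ v) \<subseteq> X"
        by (auto simp: w)
      then obtain r where "fst ` set r \<subseteq> X" "reduced_word r"
        "word_value G r = word_value G (u @ v)" "f r = f (u @ v)"
        using "1.IH" by blast
      moreover have "word_value G w = word_value G (u @ v)"
        unfolding w using uav X by (intro word_value_cancel) blast
      moreover have "f w = f (u @ v)"
        unfolding w by (rule cancel [OF uav])
      ultimately show ?thesis by auto
    qed
  qed
  obtain r r' where
    "fst ` set r \<subseteq> X" "reduced_word r" "word_value G r = word_value G w" "f r = f w"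
    "fst ` set r' \<subseteq> X" "reduced_word r'" "word_value G r' = word_value G w'" "f r' = f w'"
    using reduce assms(3,4) by meson
  note r = this
  have "inj_on (word_value G) {w. fst ` set w \<subseteq> X \<and> reduced_word w}"
    using basis by (simp add: free_basis_def bij_betw_def)
  then have "r = r'"
    by (rule inj_onD) (use r eq in auto)
  then show ?thesis
    using r by simp
qed

lemma free_basis_word_exists:
  assumes "free_basis G X" "g \<in> carrier G"
  obtains w where "fst ` set w \<subseteq> X" "word_value G w = g"
proof -
  have "g \<in> word_value G ` {w. fst ` set w \<subseteq> X \<and> reduced_word w}"
    using assms by (simp add: free_basis_def bij_betw_def)
  with that show thesis by blast
qed

end

section \<open>Collapsing edges of the Cayley graph\<close>

text \<open>
  Read a word along the Cayley graph from the vertex \<open>g\<close>. The edge between \<open>h\<close> and \<open>h \<otimes> x\<close>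
  contributes \<open>x\<close> or its inverse, according to the direction in which it is crossed, unless its
  origin \<open>h\<close> lies in \<open>D\<close>; such edges are collapsed and contribute nothing. Crossing an edge
  backwards therefore tests the vertex reached, not the vertex left.
\<close>

definition collapsed_letter :: "('a, 'b) monoid_scheme \<Rightarrow> 'a set \<Rightarrow> 'a \<Rightarrow> 'a \<times> bool \<Rightarrow> 'a" where
  "collapsed_letter G D g a =
     (if (if snd a then g else g \<otimes>\<^bsub>G\<^esub> letter_value G a) \<in> D then \<one>\<^bsub>G\<^esub> else letter_value G a)"

primrec collapsed_value ::
    "('a, 'b) monoid_scheme \<Rightarrow> 'a set \<Rightarrow> 'a \<Rightarrow> ('a \<times> bool) list \<Rightarrow> 'a" where
  "collapsed_value G D g [] = \<one>\<^bsub>G\<^esub>"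
| "collapsed_value G D g (a # w) =
     collapsed_letter G D g a \<otimes>\<^bsub>G\<^esub> collapsed_value G D (g \<otimes>\<^bsub>G\<^esub> letter_value G a) w"

definition prefix_values :: "('a, 'b) monoid_scheme \<Rightarrow> ('a \<times> bool) list \<Rightarrow> 'a set" where
  "prefix_values G w = (\<lambda>i. word_value G (take i w)) ` {..length w}"

lemma finite_prefix_values: "finite (prefix_values G w)"
  by (simp add: prefix_values_def)

context group
begin

lemma prefix_values_closed: "fst ` set w \<subseteq> carrier G \<Longrightarrow> prefix_values G w \<subseteq> carrier G"
  unfolding prefix_values_def by (auto intro!: word_value_closed dest: in_set_takeD)

lemma one_in_prefix_values: "\<one> \<in> prefix_values G w"
  unfolding prefix_values_def by (rule image_eqI [of _ _ 0]) auto

lemma prefix_values_Cons: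
  "prefix_values G (a # w) = insert \<one> ((\<otimes>) (letter_value G a) ` prefix_values G w)"
proof -
  have "{..Suc (length w)} = insert 0 (Suc ` {..length w})"
    using atMost_Suc_eq_insert_0 by blast
  then show ?thesis
    by (simp add: prefix_values_def image_image)
qed

lemma collapsed_letter_closed:
  "fst a \<in> carrier G \<Longrightarrow> collapsed_letter G D g a \<in> carrier G"
  by (simp add: collapsed_letter_def letter_value_closed)

lemma collapsed_value_closed:
  "fst ` set w \<subseteq> carrier G \<Longrightarrow> collapsed_value G D g w \<in> carrier G"
  by (induction w arbitrary: g) (auto simp: collapsed_letter_closed)

lemma collapsed_value_append:
  "\<lbrakk>fst ` set u \<subseteq> carrier G; fst ` set v \<subseteq> carrier G; g \<in> carrier G\<rbrakk>
    \<Longrightarrow> collapsed_value G D g (u @ v) =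
        collapsed_value G D g u \<otimes> collapsed_value G D (g \<otimes> word_value G u) v"
  by (induction u arbitrary: g)
    (auto simp: collapsed_letter_closed collapsed_value_closed letter_value_closed
      word_value_closed m_assoc)

lemma collapsed_letter_inverse:
  assumes "fst a \<in> carrier G" "g \<in> carrier G"
  shows "collapsed_letter G D g a \<otimes>
    collapsed_letter G D (g \<otimes> letter_value G a) (inverse_letter a) = \<one>"
  using assms
  by (auto simp: collapsed_letter_def letter_value_def inverse_letter_def m_assoc)

lemma collapsed_value_cancel:
  assumes "fst ` set (u @ a # v) \<subseteq> carrier G" "g \<in> carrier G"
  shows "collapsed_value G D g (u @ a # inverse_letter a # v) = collapsed_value G D g (u @ v)"
proof -
  let ?h = "g \<otimes> word_value G u"
  have u: "fst ` set u \<subseteq> carrier G" and v: "fst ` set v \<subseteq> carrier G" and a: "fst a \<in> carrier G"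
    and a': "fst (inverse_letter a) \<in> carrier G"
    using assms by (auto simp: inverse_letter_def)
  have h: "?h \<in> carrier G"
    using assms u by (simp add: word_value_closed)
  have return: "?h \<otimes> letter_value G a \<otimes> letter_value G (inverse_letter a) = ?h"
    using h a by (simp add: letter_value_inverse letter_value_closed m_assoc)
  have "collapsed_value G D ?h (a # inverse_letter a # v) =
      (collapsed_letter G D ?h a \<otimes> collapsed_letter G D (?h \<otimes> letter_value G a) (inverse_letter a))
        \<otimes> collapsed_value G D ?h v"
    using a a' v by (simp add: return m_assoc collapsed_letter_closed collapsed_value_closed)
  also have "\<dots> = collapsed_value G D ?h v"
    using a v h by (simp add: collapsed_letter_inverse collapsed_value_closed)
  finally show ?thesis
    using collapsed_value_append [of u "a # inverse_letter a # v" g D]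
      collapsed_value_append [of u v g D] u v a a' assms(2)
    by simp
qed

text \<open>
  Left multiplication is an automorphism of the Cayley graph that preserves the labels of its
  edges, so only the position relative to \<open>D\<close> matters.
\<close>

lemma collapsed_value_translate:
  assumes "\<And>g. g \<in> carrier G \<Longrightarrow> h \<otimes> g \<in> D \<longleftrightarrow> g \<in> D"
    and "h \<in> carrier G" "g \<in> carrier G" "fst ` set w \<subseteq> carrier G"
  shows "collapsed_value G D (h \<otimes> g) w = collapsed_value G D g w"
  using assms(3,4)
proof (induction w arbitrary: g)
  case (Cons a w)
  have a: "letter_value G a \<in> carrier G"
    using Cons.prems by (simp add: letter_value_closed)
  then have "collapsed_letter G D (h \<otimes> g) a = collapsed_letter G D g a"
    using Cons.prems assms(1,2) by (simp add: collapsed_letter_def m_assoc)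
  moreover have "collapsed_value G D (h \<otimes> (g \<otimes> letter_value G a)) w =
      collapsed_value G D (g \<otimes> letter_value G a) w"
    using Cons.prems a by (intro Cons.IH) auto
  ultimately show ?case
    using Cons.prems a assms(2) by (simp add: m_assoc)
qed simp

lemma collapsed_value_inside:
  assumes "(\<otimes>) g ` prefix_values G w \<subseteq> D" "g \<in> carrier G" "fst ` set w \<subseteq> carrier G"
  shows "collapsed_value G D g w = \<one>"
  using assms
proof (induction w arbitrary: g)
  case (Cons a w)
  have a: "letter_value G a \<in> carrier G"
    using Cons.prems by (simp add: letter_value_closed)
  have eq: "(\<otimes>) (g \<otimes> letter_value G a) ` prefix_values G w =
      (\<otimes>) g ` (\<otimes>) (letter_value G a) ` prefix_values G w"
    unfolding image_image using Cons.prems a prefix_values_closed [of w]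
    by (intro image_cong) (auto simp: m_assoc)
  have sub: "(\<otimes>) (g \<otimes> letter_value G a) ` prefix_values G w \<subseteq> D" and g: "g \<in> D"
    using Cons.prems unfolding eq prefix_values_Cons by auto
  have "g \<otimes> letter_value G a \<in> D"
    using sub one_in_prefix_values [of w] a Cons.prems by force
  then have "collapsed_letter G D g a = \<one>"
    using g by (simp add: collapsed_letter_def)
  moreover have "collapsed_value G D (g \<otimes> letter_value G a) w = \<one>"
    using Cons.prems a sub by (intro Cons.IH) auto
  ultimately show ?case by simp
qed simp

lemma collapsed_value_outside:
  assumes "(\<otimes>) g ` prefix_values G w \<inter> D = {}" "g \<in> carrier G" "fst ` set w \<subseteq> carrier G"
  shows "collapsed_value G D g w = word_value G w"
  using assms
proof (induction w arbitrary: g)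
  case (Cons a w)
  have a: "letter_value G a \<in> carrier G"
    using Cons.prems by (simp add: letter_value_closed)
  have eq: "(\<otimes>) (g \<otimes> letter_value G a) ` prefix_values G w =
      (\<otimes>) g ` (\<otimes>) (letter_value G a) ` prefix_values G w"
    unfolding image_image using Cons.prems a prefix_values_closed [of w]
    by (intro image_cong) (auto simp: m_assoc)
  have sub: "(\<otimes>) (g \<otimes> letter_value G a) ` prefix_values G w \<inter> D = {}" and g: "g \<notin> D"
    using Cons.prems unfolding eq prefix_values_Cons by auto
  have "g \<otimes> letter_value G a \<notin> D"
    using sub one_in_prefix_values [of w] a Cons.prems by force
  then have "collapsed_letter G D g a = letter_value G a"
    using g by (simp add: collapsed_letter_def)
  moreover have "collapsed_value G D (g \<otimes> letter_value G a) w = word_value G w"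
    using Cons.prems a sub by (intro Cons.IH) auto
  ultimately show ?case by simp
qed simp

section \<open>Conjugates outside the normal closure of a finite set\<close>

lemma normal_closure_least: "N \<lhd> G \<Longrightarrow> S \<subseteq> N \<Longrightarrow> normal_closure G S \<subseteq> N"
  by (auto simp: normal_closure_def)

lemma normal_closure_normal:
  assumes "S \<subseteq> carrier G"
  shows "normal_closure G S \<lhd> G"
proof -
  have "carrier G \<lhd> G"
    using normal_inv_iff subgroup_self by auto
  then have "{N. N \<lhd> G \<and> S \<subseteq> N} \<noteq> {}"
    using assms by blast
  then have "subgroup (normal_closure G S) G"
    unfolding normal_closure_def
    by (intro subgroups_Inter) (auto intro: normal_imp_subgroup)
  moreover have "x \<otimes> h \<otimes> inv x \<in> normal_closure G S"
    if "x \<in> carrier G" "h \<in> normal_closure G S" for x h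
    using that by (auto simp: normal_closure_def intro: normal.inv_op_closed2)
  ultimately show ?thesis
    by (simp add: normal_inv_iff)
qed

lemma subset_normal_closure: "S \<subseteq> normal_closure G S"
  by (auto simp: normal_closure_def)

text \<open>
  Fix a word for each element of the group. Choose \<open>D\<close> to be the union of the finitely many
  cosets of \<open>H\<close> that the words of the elements of \<open>S\<close> visit on their way from \<open>\<one>\<close>. Since \<open>D\<close> is
  invariant under \<open>H\<close>, the collapsed value of a word read from \<open>\<one>\<close> is a homomorphism on \<open>H\<close>, and
  it kills \<open>S\<close>. Up to conjugation its value at \<open>n \<otimes> k \<otimes> inv n\<close> is the collapsed value of \<open>k\<close>
  read from \<open>n\<close>; as \<open>n\<close> ranges over infinitely many cosets of \<open>H\<close>, for some \<open>n\<close> this path misses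
  \<open>D\<close>, and then the value is \<open>k \<noteq> \<one>\<close>.
\<close>

lemma conjugate_not_in_normal_closure:
  assumes basis: "free_basis G X"
    and H: "subgroup H G" and N: "N \<subseteq> carrier G"
    and normalizes: "\<And>n h. n \<in> N \<Longrightarrow> h \<in> H \<Longrightarrow> n \<otimes> h \<otimes> inv n \<in> H"
    and inf: "infinite ((\<lambda>n. H #> n) ` N)"
    and S: "finite S" "S \<subseteq> H"
    and k: "k \<in> H" "k \<noteq> \<one>"
  obtains n where "n \<in> N" "n \<otimes> k \<otimes> inv n \<notin> normal_closure (G\<lparr>carrier := H\<rparr>) S"
proof -
  interpret H: subgroup H G by (rule H)
  have X: "X \<subseteq> carrier G"
    using basis by (simp add: free_basis_def)
  have "\<forall>g\<in>carrier G. \<exists>w. fst ` set w \<subseteq> X \<and> word_value G w = g"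
    using free_basis_word_exists [OF basis] by blast
  then obtain W where WX: "\<And>g. g \<in> carrier G \<Longrightarrow> fst ` set (W g) \<subseteq> X"
    and W: "\<And>g. g \<in> carrier G \<Longrightarrow> word_value G (W g) = g"
    by (auto dest!: bchoice)
  have WC: "fst ` set (W g) \<subseteq> carrier G" if "g \<in> carrier G" for g
    using WX [OF that] X by blast
  define P where "P = (\<Union>s\<in>S. prefix_values G (W s))"
  have finP: "finite P"
    using S by (simp add: P_def finite_prefix_values)
  have P: "P \<subseteq> carrier G"
    unfolding P_def using S H.subset prefix_values_closed [OF WC] by blast
  define D where "D = (\<Union>p\<in>P. H #> p)"
  have D: "g \<in> D \<longleftrightarrow> (\<exists>p\<in>P. H #> g = H #> p)" if "g \<in> carrier G" for g
    unfolding D_def using that P H rcos_self repr_independence by blast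
  have D_invariant: "h \<otimes> g \<in> D \<longleftrightarrow> g \<in> D" if "h \<in> H" "g \<in> carrier G" for h g
  proof -
    have "H #> (h \<otimes> g) = H #> g"
      using that by (simp add: coset_mult_assoc [symmetric] H.subset H.rcos_const is_group)
    with that show ?thesis
      by (simp add: D)
  qed
  define c where "c g h = collapsed_value G D g (W h)" for g h
  have c_closed: "c g h \<in> carrier G" if "h \<in> carrier G" for g h
    unfolding c_def using WC [OF that] by (rule collapsed_value_closed)
  have c_word: "c g (word_value G w) = collapsed_value G D g w"
    if "g \<in> carrier G" "fst ` set w \<subseteq> X" for g w
  proof -
    have w: "word_value G w \<in> carrier G"
      using that X by (intro word_value_closed) blast
    show ?thesis
      unfolding c_def
    proof (rule free_basis_word_invariant [OF basis])
      fix u v and a :: "'a \<times> bool" assume "fst ` set (u @ a # v) \<subseteq> X"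
      then show "collapsed_value G D g (u @ a # inverse_letter a # v) = collapsed_value G D g (u @ v)"
        using X that by (intro collapsed_value_cancel) blast+
    qed (use that w WX W in auto)
  qed
  have c_mult: "c g (x \<otimes> y) = c g x \<otimes> c (g \<otimes> x) y"
    if "g \<in> carrier G" "x \<in> carrier G" "y \<in> carrier G" for g x y
  proof -
    have "word_value G (W x @ W y) = x \<otimes> y"
      using that by (simp add: word_value_append WC W)
    then have "c g (x \<otimes> y) = collapsed_value G D g (W x @ W y)"
      using c_word [of g "W x @ W y"] that WX by (simp add: image_Un)
    then show ?thesis
      using that by (simp add: collapsed_value_append WC W c_def)
  qed
  have c_translate: "c (h \<otimes> g) x = c g x" if "h \<in> H" "g \<in> carrier G" "x \<in> carrier G" for h g x
    unfolding c_def using that D_invariant WC H.subset by (intro collapsed_value_translate) auto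
  have c_one: "c g \<one> = \<one>" if "g \<in> carrier G" for g
    using c_word [of g "[]"] that by simp
  interpret GH: group "G\<lparr>carrier := H\<rparr>"
    by (rule subgroup_imp_group [OF H])
  have "c \<one> \<in> hom (G\<lparr>carrier := H\<rparr>) G"
  proof (rule homI)
    fix x y assume xy: "x \<in> carrier (G\<lparr>carrier := H\<rparr>)" "y \<in> carrier (G\<lparr>carrier := H\<rparr>)"
    then have "x \<in> H" "y \<in> carrier G" "x \<in> carrier G" by auto
    then show "c \<one> (x \<otimes>\<^bsub>G\<lparr>carrier := H\<rparr>\<^esub> y) = c \<one> x \<otimes> c \<one> y"
      using c_mult [of \<one> x y] c_translate [of x \<one> y] by simp
  qed (auto intro: c_closed)
  then have hom: "group_hom (G\<lparr>carrier := H\<rparr>) G (c \<one>)"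
    by (intro group_hom.intro group_hom_axioms.intro GH.is_group is_group)
  define M where "M = kernel (G\<lparr>carrier := H\<rparr>) G (c \<one>)"
  have "M \<lhd> G\<lparr>carrier := H\<rparr>"
    unfolding M_def by (rule group_hom.normal_kernel [OF hom])
  moreover have "S \<subseteq> M"
  proof
    fix s assume s: "s \<in> S"
    then have sC: "s \<in> carrier G"
      using S by auto
    have "prefix_values G (W s) \<subseteq> D"
    proof
      fix p assume p: "p \<in> prefix_values G (W s)"
      then have "p \<in> P" using s by (auto simp: P_def)
      then show "p \<in> D" using D P by blast
    qed
    moreover have "(\<otimes>) \<one> ` prefix_values G (W s) = prefix_values G (W s)"
      using prefix_values_closed [OF WC [OF sC]] by force
    ultimately have "c \<one> s = \<one>"
      unfolding c_def by (intro collapsed_value_inside WC sC) auto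
    with s S show "s \<in> M"
      by (auto simp: M_def kernel_def)
  qed
  ultimately have closure: "normal_closure (G\<lparr>carrier := H\<rparr>) S \<subseteq> M"
    using H group.normal_closure_least subgroup_imp_group by blast
  have kC: "k \<in> carrier G"
    using k by auto
  let ?Q = "prefix_values G (W k)"
  have Q: "?Q \<subseteq> carrier G"
    by (intro prefix_values_closed WC kC)
  \<comment> \<open>The path of \<open>k\<close> from \<open>n\<close> meets \<open>D\<close> only if \<open>n\<close> lies in one of the finitely many cosets
    \<open>H #> (p \<otimes> inv q)\<close>.\<close>
  obtain n where n: "n \<in> N" "(\<otimes>) n ` ?Q \<inter> D = {}"
  proof (rule ccontr)
    assume neg: "\<not> thesis"
    have "(\<lambda>n. H #> n) ` N \<subseteq> (\<lambda>(p, q). H #> (p \<otimes> inv q)) ` (P \<times> ?Q)"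
    proof clarify
      fix n assume nN: "n \<in> N"
      with neg that obtain q where q: "q \<in> ?Q" "n \<otimes> q \<in> D" by blast
      have C: "n \<in> carrier G" "q \<in> carrier G"
        using nN N q Q by auto
      with q D obtain p where p: "p \<in> P" "H #> (n \<otimes> q) = H #> p"
        by auto
      have pC: "p \<in> carrier G"
        using p P by auto
      have "H #> n = H #> (n \<otimes> q) #> inv q"
        using C by (simp add: coset_mult_assoc H.subset m_assoc)
      also have "\<dots> = H #> (p \<otimes> inv q)"
        using C p pC by (simp add: coset_mult_assoc H.subset)
      finally show "H #> n \<in> (\<lambda>(p, q). H #> (p \<otimes> inv q)) ` (P \<times> ?Q)"
        using p q by auto
    qed
    then show False
      using inf finP finite_prefix_values finite_subset by (metis finite_SigmaI finite_imageI)
  qed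
  have nC: "n \<in> carrier G"
    using n N by auto
  have "c n k = k"
    unfolding c_def using collapsed_value_outside [OF n(2) nC WC [OF kC]] W [OF kC] by simp
  let ?y = "n \<otimes> k \<otimes> inv n"
  have y: "?y \<in> H"
    using n k normalizes by blast
  have nk: "n \<otimes> k = ?y \<otimes> n"
    using nC kC by (simp add: m_assoc)
  have "c \<one> ?y = c \<one> n \<otimes> c n k \<otimes> c (n \<otimes> k) (inv n)"
    using nC kC by (simp add: c_mult)
  also have "c (n \<otimes> k) (inv n) = c n (inv n)"
    using c_translate [OF y nC, of "inv n"] nC by (simp flip: nk)
  also have "c n (inv n) = inv (c \<one> n)"
  proof -
    have "c \<one> n \<otimes> c n (inv n) = \<one>"
      using c_mult [of \<one> n "inv n"] c_one [of \<one>] nC by simp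
    then have "inv (c n (inv n)) = c \<one> n"
      using nC by (intro inv_equality c_closed) auto
    then show ?thesis
      using inv_inv [OF c_closed [of "inv n" n]] nC by simp
  qed
  finally have "c \<one> ?y = c \<one> n \<otimes> k \<otimes> inv (c \<one> n)"
    using \<open>c n k = k\<close> by simp
  moreover have "k = inv (c \<one> n) \<otimes> (c \<one> n \<otimes> k \<otimes> inv (c \<one> n)) \<otimes> c \<one> n"
    using kC c_closed [OF nC, of \<one>] by (simp add: m_assoc inv_solve_left)
  ultimately have "c \<one> ?y \<noteq> \<one>"
    using k c_closed [OF nC, of \<one>] by auto
  then have "?y \<notin> M"
    by (simp add: M_def kernel_def)
  with closure that n(1) show thesis by blast
qed

text \<open>
  If only finitely many cosets of the normal closure of \<open>S\<close> met \<open>N\<close>, then adding to \<open>S\<close> a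
  representative of each would give a finite set whose normal closure contains \<open>N\<close>.
\<close>

lemma infinite_cosets_normal_closure:
  assumes basis: "free_basis G X"
    and H: "subgroup H G" and L: "L \<subseteq> carrier G"
    and normalizes: "\<And>n h. n \<in> L \<Longrightarrow> h \<in> H \<Longrightarrow> n \<otimes> h \<otimes> inv n \<in> H"
    and inf: "infinite ((\<lambda>n. H #> n) ` L)"
    and S: "finite S" "S \<subseteq> H"
    and N: "N \<subseteq> H" "\<not> N \<subseteq> {\<one>}"
    and conj: "\<And>n k. n \<in> L \<Longrightarrow> k \<in> N \<Longrightarrow> n \<otimes> k \<otimes> inv n \<in> N"
  shows "infinite ((\<lambda>n. normal_closure (G\<lparr>carrier := H\<rparr>) S #> n) ` N)"
proof
  let ?C = "normal_closure (G\<lparr>carrier := H\<rparr>)"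
  interpret H: subgroup H G by (rule H)
  assume "finite ((\<lambda>n. ?C S #> n) ` N)"
  then obtain T where T: "T \<subseteq> N" "finite T" "(\<lambda>n. ?C S #> n) ` N = (\<lambda>n. ?C S #> n) ` T"
    by (meson finite_subset_image order_refl)
  have sub: "?C A \<lhd> G\<lparr>carrier := H\<rparr>" if "A \<subseteq> H" for A
    using group.normal_closure_normal [OF subgroup_imp_group [OF H]] that by simp
  have subG: "subgroup (?C A) G" if "A \<subseteq> H" for A
    using sub [OF that] H incl_subgroup normal_imp_subgroup by blast
  have ST: "S \<union> T \<subseteq> H"
    using S T N by blast
  have mono: "?C S \<subseteq> ?C (S \<union> T)"
    by (auto simp: normal_closure_def)
  have "N \<subseteq> ?C (S \<union> T)"
  proof
    fix x assume x: "x \<in> N"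
    then obtain t where t: "t \<in> T" "?C S #> x = ?C S #> t"
      using T(3) by blast
    have "x \<in> carrier G" "t \<in> carrier G"
      using x t T N by auto
    then have "x \<in> ?C S #> t"
      using t subG [OF S(2)] rcos_self by metis
    then obtain s where s: "s \<in> ?C S" "x = s \<otimes> t"
      by (auto simp: r_coset_def)
    moreover have "t \<in> ?C (S \<union> T)"
      using t by (auto simp: normal_closure_def)
    ultimately show "x \<in> ?C (S \<union> T)"
      using subgroup.m_closed [OF subG [OF ST]] mono by blast
  qed
  moreover obtain k where k: "k \<in> N" "k \<noteq> \<one>"
    using N by blast
  moreover obtain n where "n \<in> L" "n \<otimes> k \<otimes> inv n \<notin> ?C (S \<union> T)"
    using conjugate_not_in_normal_closure [OF basis H L normalizes inf _ ST] k N S T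
    by (metis finite_UnI subsetD)
  ultimately show False
    using conj by blast
qed

end

section \<open>Descending along a subnormal chain\<close>

lemma subnormal_closure_Suc:
  "subnormal_closure G S (Suc l) =
    subnormal_closure (G\<lparr>carrier := normal_closure G S\<rparr>) S l"
proof (induction l)
  case (Suc l)
  then show ?case
    by (subst subnormal_closure.simps(2), subst Suc.IH) simp
qed simp

lemma (in group) normalI_conj:
  assumes "subgroup A G" "subgroup B G" "A \<subseteq> B"
    and "\<And>b a. b \<in> B \<Longrightarrow> a \<in> A \<Longrightarrow> b \<otimes> a \<otimes> inv b \<in> A"
  shows "A \<lhd> G\<lparr>carrier := B\<rparr>"
proof -
  interpret B: group "G\<lparr>carrier := B\<rparr>"
    by (rule subgroup_imp_group [OF assms(2)])
  show ?thesis
    using assms by (simp add: B.normal_inv_iff subgroup_incl m_inv_consistent)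
qed

lemma (in group) normal_conj:
  assumes "A \<lhd> G\<lparr>carrier := B\<rparr>" "subgroup B G" "b \<in> B" "a \<in> A"
  shows "b \<otimes> a \<otimes> inv b \<in> A"
  using normal.inv_op_closed2 [OF assms(1), of b a] assms by (simp add: m_inv_consistent)

lemma (in group) normal_subgroup_trans:
  assumes "A \<lhd> G\<lparr>carrier := B\<rparr>" "subgroup B G"
  shows "subgroup A G"
  using assms incl_subgroup normal_imp_subgroup by blast

lemma (in group) subnormal_imp_subgroup:
  assumes "subnormal l K G"
  shows "subgroup K G"
proof -
  obtain C where C: "C 0 = carrier G" "C l = K"
    and step: "\<And>i. i < l \<Longrightarrow> C (Suc i) \<lhd> G\<lparr>carrier := C i\<rparr>"
    using assms by (auto simp: subnormal_def)
  have "subgroup (C i) G" if "i \<le> l" for i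
    using that
  proof (induction i)
    case (Suc i)
    then show ?case
      using normal_subgroup_trans [OF step [of i]] by simp
  qed (simp add: C subgroup_self)
  with C show ?thesis by blast
qed

lemma (in group) normal_Int:
  assumes AB: "A \<lhd> G\<lparr>carrier := B\<rparr>" and B: "subgroup B G" and H: "subgroup H G"
  shows "A \<inter> H \<lhd> G\<lparr>carrier := B \<inter> H\<rparr>"
proof (rule normalI_conj)
  show "subgroup (A \<inter> H) G" "subgroup (B \<inter> H) G"
    using normal_subgroup_trans [OF AB B] B H by (auto intro: subgroups_Inter_pair)
  show "A \<inter> H \<subseteq> B \<inter> H"
    using normal_imp_subgroup [OF AB] subgroup.subset by fastforce
  show "b \<otimes> a \<otimes> inv b \<in> A \<inter> H" if "b \<in> B \<inter> H" "a \<in> A \<inter> H" for a b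
    using that normal_conj [OF AB B] H
    by (auto intro!: subgroup.m_closed subgroup.m_inv_closed)
qed

text \<open>
  The first step of the chain from \<open>L\<close> to \<open>K\<close> is split off, and the rest is intersected with
  \<open>H\<close>, which changes neither \<open>K\<close> nor the normality of each term in the preceding one.
\<close>

lemma (in group) subnormal_Suc_Int:
  assumes K: "subnormal (Suc l) K (G\<lparr>carrier := L\<rparr>)"
    and L: "subgroup L G" and H: "subgroup H G" and "K \<subseteq> H"
  obtains N where "N \<lhd> G\<lparr>carrier := L\<rparr>" "subnormal l K (G\<lparr>carrier := N \<inter> H\<rparr>)"
proof -
  obtain C where C: "C 0 = L" "C (Suc l) = K"
    and step: "\<And>i. i < Suc l \<Longrightarrow> C (Suc i) \<lhd> G\<lparr>carrier := C i\<rparr>"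
    using K by (auto simp: subnormal_def)
  have sub: "subgroup (C i) G" if "i \<le> Suc l" for i
    using that
  proof (induction i)
    case (Suc i)
    then show ?case
      using normal_subgroup_trans [OF step [of i]] by simp
  qed (simp add: C L)
  have "subnormal l K (G\<lparr>carrier := C (Suc 0) \<inter> H\<rparr>)"
    unfolding subnormal_def
  proof (intro exI [of _ "\<lambda>i. C (Suc i) \<inter> H"] conjI allI impI)
    show "C (Suc l) \<inter> H = K"
      using C \<open>K \<subseteq> H\<close> by blast
    fix i assume "i < l"
    then show "C (Suc (Suc i)) \<inter> H \<lhd> G\<lparr>carrier := C (Suc 0) \<inter> H, carrier := C (Suc i) \<inter> H\<rparr>"
      using normal_Int [OF step sub H] by simp
  qed simp
  moreover have "C (Suc 0) \<lhd> G\<lparr>carrier := L\<rparr>"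
    using step [of 0] C by simp
  ultimately show thesis
    using that by blast
qed

lemma (in group) subgroup_subnormal_closure:
  assumes "S \<subseteq> carrier G"
  shows "subgroup (subnormal_closure G S l) G \<and> S \<subseteq> subnormal_closure G S l"
proof (induction l)
  case 0
  then show ?case using assms subgroup_self by simp
next
  case (Suc l)
  let ?B = "subnormal_closure G S l"
  interpret B: group "G\<lparr>carrier := ?B\<rparr>"
    using Suc subgroup_imp_group by blast
  have "normal_closure (G\<lparr>carrier := ?B\<rparr>) S \<lhd> G\<lparr>carrier := ?B\<rparr>"
    using Suc by (intro B.normal_closure_normal) simp
  then show ?case
    using Suc normal_subgroup_trans B.subset_normal_closure by simp
qed

text \<open>
  This generalizes the theorem so that it can be proved by induction on \<open>l\<close>: the group \<open>L\<close> in
  which \<open>K\<close> is subnormal need no longer contain \<open>H\<close>, but only normalize it. In the inductive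
  step \<open>L\<close> shrinks to the intersection of \<open>H\<close> with the next term of the chain from \<open>L\<close> to \<open>K\<close>,
  and \<open>H\<close> to the normal closure of \<open>S\<close> in \<open>H\<close>. The induction starts at \<open>l = 0\<close>, where
  \<open>K = L\<close> cannot lie in \<open>H\<close> because it meets infinitely many cosets of \<open>H\<close>.
\<close>

lemma (in group) subnormal_in_subnormal_closure_trivial:
  assumes basis: "free_basis G X"
    and "subgroup L G" "subgroup H G"
    and "\<And>n h. n \<in> L \<Longrightarrow> h \<in> H \<Longrightarrow> n \<otimes> h \<otimes> inv n \<in> H"
    and "infinite ((\<lambda>n. H #> n) ` L)"
    and S: "finite S" and "S \<subseteq> H"
    and "subnormal l K (G\<lparr>carrier := L\<rparr>)"
    and "K \<subseteq> subnormal_closure (G\<lparr>carrier := H\<rparr>) S l"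
  shows "K \<subseteq> {\<one>}"
  using assms(2-5,7-)
proof (induction l arbitrary: L H)
  case 0
  then have "L \<subseteq> H"
    by (auto simp: subnormal_def)
  moreover have "H #> n = H" if "n \<in> H" for n
    by (rule subgroup.rcos_const [OF 0(2) is_group that])
  ultimately have "(\<lambda>n. H #> n) ` L \<subseteq> {H}"
    by auto
  then have "finite ((\<lambda>n. H #> n) ` L)"
    by (rule finite_subset) simp
  with 0(4) show ?case
    by contradiction
next
  case (Suc l)
  note L = Suc.prems(1) and H = Suc.prems(2) and conjH = Suc.prems(3)
  interpret GH: group "G\<lparr>carrier := H\<rparr>"
    by (rule subgroup_imp_group [OF H])
  let ?H' = "normal_closure (G\<lparr>carrier := H\<rparr>) S"
  have H': "?H' \<lhd> G\<lparr>carrier := H\<rparr>"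
    using Suc.prems by (intro GH.normal_closure_normal) simp
  have "K \<subseteq> H"
    using Suc.prems GH.subgroup_subnormal_closure [of S "Suc l", THEN conjunct1, THEN subgroup.subset]
    by auto
  then obtain N where N: "N \<lhd> G\<lparr>carrier := L\<rparr>"
    and K: "subnormal l K (G\<lparr>carrier := N \<inter> H\<rparr>)"
    using subnormal_Suc_Int Suc.prems by metis
  have NH: "subgroup (N \<inter> H) G"
    using normal_subgroup_trans [OF N L] H by (rule subgroups_Inter_pair)
  show ?case
  proof (cases "N \<inter> H \<subseteq> {\<one>}")
    case True
    have "K \<subseteq> N \<inter> H"
      using group.subnormal_imp_subgroup [OF subgroup_imp_group [OF NH] K] subgroup.subset
      by fastforce
    with True show ?thesis by blast
  next
    case False
    have "infinite ((\<lambda>n. ?H' #> n) ` (N \<inter> H))"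
    proof (rule infinite_cosets_normal_closure [OF basis H _ conjH])
      show "L \<subseteq> carrier G"
        using L by (rule subgroup.subset)
      show "n \<otimes> k \<otimes> inv n \<in> N \<inter> H" if "n \<in> L" "k \<in> N \<inter> H" for n k
        using that normal_conj [OF N L] conjH by blast
    qed (use Suc.prems S False in auto)
    moreover have "n \<otimes> h \<otimes> inv n \<in> ?H'" if "n \<in> N \<inter> H" "h \<in> ?H'" for n h
      using that normal_conj [OF H' H] by blast
    moreover have "K \<subseteq> subnormal_closure (G\<lparr>carrier := ?H'\<rparr>) S l"
      using Suc.prems subnormal_closure_Suc [of "G\<lparr>carrier := H\<rparr>" S l] by simp
    ultimately show ?thesis
      using GH.subset_normal_closure K
      by (intro Suc.IH [OF NH normal_subgroup_trans [OF H' H]])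
  qed
qed

theorem corollary1p2:
  fixes F :: "('a, 'b) monoid_scheme" and H S :: "'a set" and l :: nat
  assumes "l \<ge> 1"
    and "free_group F"
    and "H \<lhd> F"
    and "infinite (rcosets\<^bsub>F\<^esub> H)"
    and "finite S"
    and "S \<subseteq> H"
  shows "\<not> (\<exists>K. subnormal l K F \<and> K \<noteq> {\<one>\<^bsub>F\<^esub>} \<and>
               K \<subseteq> subnormal_closure (F\<lparr>carrier := H\<rparr>) S l)"
proof
  interpret F: group F
    using assms(2) by (simp add: free_group_def)
  obtain X where basis: "free_basis F X"
    using assms(2) by (auto simp: free_group_def)
  have H: "subgroup H F"
    using assms(3) by (rule normal_imp_subgroup)
  assume "\<exists>K. subnormal l K F \<and> K \<noteq> {\<one>\<^bsub>F\<^esub>} \<and> K \<subseteq> subnormal_closure (F\<lparr>carrier := H\<rparr>) S l"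
  then obtain K where K: "subnormal l K F" "K \<noteq> {\<one>\<^bsub>F\<^esub>}"
    "K \<subseteq> subnormal_closure (F\<lparr>carrier := H\<rparr>) S l" by blast
  have "rcosets\<^bsub>F\<^esub> H = (\<lambda>n. H #>\<^bsub>F\<^esub> n) ` carrier F"
    by (auto simp: RCOSETS_def)
  then have "infinite ((\<lambda>n. H #>\<^bsub>F\<^esub> n) ` carrier F)"
    using assms(4) by simp
  then have "K \<subseteq> {\<one>\<^bsub>F\<^esub>}"
    using F.subnormal_in_subnormal_closure_trivial [OF basis F.subgroup_self H, of S l K]
      K assms(3,5,6) by (simp add: normal.inv_op_closed2)
  moreover have "\<one>\<^bsub>F\<^esub> \<in> K"
    using F.subnormal_imp_subgroup [OF K(1)] by (rule subgroup.one_closed)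
  ultimately show False
    using K(2) by blast
qed

end
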